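(* For every $b>1$ there exists a family of unit-weight instances $(\vec p_L)_L$ for single-machine scheduling minimizing $\sum_j C_j$ such that $$\lim_{L\to\infty}\frac{D_b(\vec p_L)}{\mathrm{OPT}(\vec p_L)}=1+\frac{2b^{3/2}}{b-1}.$$
   Context: An instance consists of $n$ jobs with processing times $p_j>0$ and unit weights on a single machine; objective $\sum_j C_j$; $\mathrm{OPT}$ is the optimal clairvoyant objective value (processing in nondecreasing order of $p_j$). Kill-and-restart model: a probing of job $j$ for time $\tau$ completes $j$ after $p_j$ time units if $\tau\geq p_j$; otherwise it is aborted after $\tau$ time units and all progress is lost. The $b$-scaling strategy $D_b$ (here with unit weights): rounds $q\in\mathbb{Z}$ in increasing order starting from $-\infty$; in round $q$ every not yet completed job is probed, in order of increasing index, for time $b^q$; probings are executed back to back from time $0$ without idling; formally $D_b$ is the limit as $q_0\to-\infty$ of the algorithm starting with round $q_0$, so at the start of round $q$ every unfinished job has been probed for total time $b^q/(b-1)$. $D_b(\vec p)$ denotes the objective value of its schedule. *)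

theory Defs
  imports Complex_Main "HOL-Library.Multiset"
begin

text \<open>
  An instance with unit weights is the list \<open>p\<close> of its processing times; the job with
  index \<open>j < length p\<close> has processing time \<open>p ! j\<close>.
\<close>

definition is_instance :: "real list \<Rightarrow> bool" where
  "is_instance p \<longleftrightarrow> p \<noteq> [] \<and> (\<forall>x\<in>set p. x > 0)"


section \<open>The clairvoyant optimum\<close>

text \<open>
  \<open>seq_cost xs\<close> is the sum of completion times when jobs with processing times \<open>xs\<close> are
  processed nonpreemptively, in this order, without idling from time 0.
\<close>

definition seq_cost :: "real list \<Rightarrow> real" where
  "seq_cost xs = (\<Sum>k<length xs. \<Sum>i\<le>k. xs ! i)"

definition OPT :: "real list \<Rightarrow> real" where
  "OPT p = Min (seq_cost ` {xs. mset xs = mset p})"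

lemma seq_cost_Cons: "seq_cost (x # xs) = real (length xs + 1) * x + seq_cost xs"
proof -
  have "seq_cost (x # xs) = (\<Sum>k<Suc (length xs). \<Sum>i<Suc k. (x # xs) ! i)"
    by (simp add: seq_cost_def lessThan_Suc_atMost)
  also have "\<dots> = (\<Sum>k<Suc (length xs). x + (\<Sum>i<k. xs ! i))"
    by (intro sum.cong refl) (simp add: sum.lessThan_Suc_shift del: sum.lessThan_Suc)
  also have "\<dots> = real (length xs + 1) * x + (\<Sum>k<Suc (length xs). \<Sum>i<k. xs ! i)"
    by (simp add: sum.distrib algebra_simps)
  also have "(\<Sum>k<Suc (length xs). \<Sum>i<k. xs ! i) = (\<Sum>k<length xs. \<Sum>i<Suc k. xs ! i)"
    by (subst sum.lessThan_Suc_shift) simp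
  finally show ?thesis
    by (simp add: seq_cost_def lessThan_Suc_atMost del: sum.lessThan_Suc)
qed

lemma seq_cost_insort_le: "seq_cost (insort x xs) \<le> seq_cost (x # xs)"
proof (induction xs)
  case Nil
  then show ?case by simp
next
  case (Cons y ys)
  show ?case
  proof (cases "x \<le> y")
    case True
    then show ?thesis by simp
  next
    case False
    then have "seq_cost (insort x (y # ys)) = real (length ys + 2) * y + seq_cost (insort x ys)"
      by (simp add: seq_cost_Cons)
    also have "\<dots> \<le> real (length ys + 2) * y + (real (length ys + 1) * x + seq_cost ys)"
      using Cons by (simp add: seq_cost_Cons)
    also have "\<dots> \<le> seq_cost (x # y # ys)"
      using False by (simp add: seq_cost_Cons algebra_simps)
    finally show ?thesis .
  qed
qed

lemma seq_cost_sort_le: "seq_cost (sort xs) \<le> seq_cost xs"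
proof (induction xs)
  case Nil
  then show ?case by simp
next
  case (Cons x xs)
  have "seq_cost (sort (x # xs)) \<le> seq_cost (x # sort xs)"
    using seq_cost_insort_le by simp
  also have "\<dots> \<le> seq_cost (x # xs)"
    using Cons by (simp add: seq_cost_Cons)
  finally show ?case .
qed

lemma OPT_eq_sort: "OPT p = seq_cost (sort p)"
  unfolding OPT_def
proof (rule Min_eqI)
  show "finite (seq_cost ` {xs. mset xs = mset p})"
    by (simp add: mset_eq_finite)
next
  fix c assume "c \<in> seq_cost ` {xs. mset xs = mset p}"
  then obtain xs where xs: "mset xs = mset p" "c = seq_cost xs" by auto
  then have "sort p = sort xs"
    by (metis properties_for_sort mset_sort sorted_sort)
  then show "seq_cost (sort p) \<le> c"
    using seq_cost_sort_le[of xs] xs by simp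
qed auto


section \<open>The \<open>b\<close>-scaling strategy\<close>

text \<open>
  A state \<open>(t, C)\<close> consists of the current time \<open>t\<close> and the completion times \<open>C\<close> of the
  jobs completed so far.
\<close>

type_synonym state = "real \<times> (nat \<Rightarrow> real option)"

fun probe :: "real list \<Rightarrow> real \<Rightarrow> nat \<Rightarrow> state \<Rightarrow> state" where
  "probe p \<tau> j (t, C) =
     (if C j \<noteq> None then (t, C)
      else if \<tau> \<ge> p ! j then (t + p ! j, C(j \<mapsto> t + p ! j))
      else (t + \<tau>, C))"

definition probe_round :: "real list \<Rightarrow> real \<Rightarrow> state \<Rightarrow> state" where
  "probe_round p \<tau> s = fold (probe p \<tau>) [0..<length p] s"

text \<open>The state after the \<open>k\<close> rounds \<open>q0, \<dots>, q0 + k - 1\<close>:\<close>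

primrec scaling_run :: "real \<Rightarrow> real list \<Rightarrow> int \<Rightarrow> nat \<Rightarrow> state" where
  "scaling_run b p q0 0 = (0, Map.empty)"
| "scaling_run b p q0 (Suc k) = probe_round p (b powi (q0 + int k)) (scaling_run b p q0 k)"

definition all_done :: "real list \<Rightarrow> state \<Rightarrow> bool" where
  "all_done p s \<longleftrightarrow> (\<forall>j<length p. snd s j \<noteq> None)"

definition scaling_cost_from :: "real \<Rightarrow> real list \<Rightarrow> int \<Rightarrow> real" where
  "scaling_cost_from b p q0 =
     (\<Sum>j<length p. the (snd (scaling_run b p q0 (LEAST k. all_done p (scaling_run b p q0 k))) j))"

definition scaling_cost :: "real \<Rightarrow> real list \<Rightarrow> real" where
  "scaling_cost b p = Lim at_bot (\<lambda>q0::int. scaling_cost_from b p q0)"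


text \<open>
  The \<open>LEAST\<close> and the limit above are well defined: see \<open>all_done_eventually\<close> and
  \<open>scaling_cost_from_tendsto\<close>. Moreover, \<open>scaling_cost_eq\<close> shows that \<open>scaling_cost\<close> is
  the cost of the run that enters a round \<open>q0\<close>, before which no job can complete, after
  each of the \<open>n\<close> jobs has been probed for total time \<open>b powi q0 / (b - 1)\<close>
  (delaying all \<open>n\<close> completions by \<open>n\<close> times this amount).
\<close>

lemma fold_probe_mono: "snd s j \<noteq> None \<Longrightarrow> snd (fold (probe p \<tau>) js s) j \<noteq> None"
proof (induction js arbitrary: s)
  case (Cons i js)
  have "snd (probe p \<tau> i s) j \<noteq> None"
    using Cons.prems by (cases s) auto
  then show ?case using Cons.IH by simp
qed simp

lemma fold_probe_done:
  "j \<in> set js \<Longrightarrow> p ! j \<le> \<tau> \<Longrightarrow> snd (fold (probe p \<tau>) js s) j \<noteq> None"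
proof (induction js arbitrary: s)
  case (Cons i js)
  show ?case
  proof (cases "i = j")
    case True
    have "snd (probe p \<tau> j s) j \<noteq> None"
      using Cons.prems by (cases s) auto
    then show ?thesis using True fold_probe_mono[of "probe p \<tau> j s" j] by simp
  next
    case False
    then show ?thesis using Cons by simp
  qed
qed simp

lemma powi_ge_eventually:
  assumes "b > (1::real)"
  shows "\<exists>k. b powi (q0 + int k) \<ge> x"
proof -
  obtain k where "x / b powi q0 < b ^ k"
    using real_arch_pow[OF assms] by blast
  then have "x \<le> b powi q0 * b ^ k"
    using assms by (simp add: field_simps)
  also have "\<dots> = b powi (q0 + int k)"
    using assms by (simp add: power_int_add)
  finally show ?thesis by blast
qed

lemma all_done_eventually:
  assumes "b > 1"
  shows "\<exists>k. all_done p (scaling_run b p q0 k)"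
proof -
  obtain k where k: "b powi (q0 + int k) \<ge> Max (set p)"
    using powi_ge_eventually[OF assms] by blast
  have "all_done p (scaling_run b p q0 (Suc k))"
    unfolding all_done_def
  proof (intro allI impI)
    fix j assume j: "j < length p"
    then have "p ! j \<le> b powi (q0 + int k)"
      using k by (meson List.finite_set Max_ge nth_mem order_trans)
    then show "snd (scaling_run b p q0 (Suc k)) j \<noteq> None"
      using j fold_probe_done[of j "[0..<length p]"] by (simp add: probe_round_def)
  qed
  then show ?thesis by blast
qed

definition shift :: "real \<Rightarrow> state \<Rightarrow> state" where
  "shift d s = (fst s + d, \<lambda>j. map_option (\<lambda>c. c + d) (snd s j))"

lemma probe_shift: "probe p \<tau> j (shift d s) = shift d (probe p \<tau> j s)"
  by (cases s) (auto simp: shift_def fun_eq_iff)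

lemma probe_round_shift: "probe_round p \<tau> (shift d s) = shift d (probe_round p \<tau> s)"
proof -
  have "fold (probe p \<tau>) js (shift d s) = shift d (fold (probe p \<tau>) js s)" for js
    by (induction js arbitrary: s) (simp_all add: probe_shift)
  then show ?thesis by (simp add: probe_round_def)
qed

lemma probe_round_small:
  assumes "\<forall>x\<in>set p. \<tau> < x"
  shows "probe_round p \<tau> (t, Map.empty) = (t + real (length p) * \<tau>, Map.empty)"
proof -
  have "fold (probe p \<tau>) js (t, Map.empty) = (t + real (length js) * \<tau>, Map.empty)"
    if "set js \<subseteq> {..<length p}" for js
    using that
  proof (induction js arbitrary: t)
    case (Cons j js)
    then have "\<tau> < p ! j" using assms by auto
    then show ?case using Cons by (simp add: algebra_simps)
  qed simp
  from this[of "[0..<length p]"] show ?thesis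
    by (simp add: probe_round_def atLeast_upt)
qed

lemma scaling_run_step:
  assumes "\<forall>x\<in>set p. b powi q0 < x"
  shows "scaling_run b p q0 (Suc k) =
           shift (real (length p) * b powi q0) (scaling_run b p (q0 + 1) k)"
proof (induction k)
  case 0
  then show ?case using probe_round_small[OF assms, of 0] by (simp add: shift_def)
next
  case (Suc k)
  have "scaling_run b p q0 (Suc (Suc k)) =
      probe_round p (b powi (q0 + 1 + int k)) (scaling_run b p q0 (Suc k))"
    by (simp add: add_ac)
  also have "\<dots> = shift (real (length p) * b powi q0) (scaling_run b p (q0 + 1) (Suc k))"
    unfolding Suc probe_round_shift[symmetric] by (simp add: probe_round_shift)
  finally show ?case .
qed

lemma scaling_cost_from_step:
  assumes "b > 1" and small: "\<forall>x\<in>set p. b powi q0 < x"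
  shows "scaling_cost_from b p q0 =
           scaling_cost_from b p (q0 + 1) + (real (length p))\<^sup>2 * b powi q0"
proof (cases "p = []")
  case True
  then show ?thesis by (simp add: scaling_cost_from_def)
next
  case False
  let ?d = "real (length p) * b powi q0"
  let ?K = "LEAST k. all_done p (scaling_run b p (q0 + 1) k)"
  have eq: "all_done p (scaling_run b p q0 (Suc k)) \<longleftrightarrow> all_done p (scaling_run b p (q0 + 1) k)" for k
    unfolding scaling_run_step[OF small] by (simp add: all_done_def shift_def)
  obtain k where k: "all_done p (scaling_run b p q0 k)"
    using all_done_eventually[OF assms(1)] by blast
  have "(LEAST k. all_done p (scaling_run b p q0 k)) =
      Suc (LEAST k. all_done p (scaling_run b p q0 (Suc k)))"
    using k False by (intro Least_Suc[where n = k]) (auto simp: all_done_def)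
  then have L: "(LEAST k. all_done p (scaling_run b p q0 k)) = Suc ?K"
    by (simp only: eq)
  have dn: "all_done p (scaling_run b p (q0 + 1) ?K)"
    using all_done_eventually[OF assms(1)] by (rule LeastI_ex)
  have "scaling_cost_from b p q0 =
      (\<Sum>j<length p. the (snd (scaling_run b p (q0 + 1) ?K) j) + ?d)"
    unfolding scaling_cost_from_def L scaling_run_step[OF small]
    using dn by (intro sum.cong refl) (auto simp: shift_def all_done_def option.map_sel)
  then show ?thesis
    by (simp add: scaling_cost_from_def sum.distrib power2_eq_square)
qed

lemma scaling_cost_from_start:
  assumes "b > 1" and small: "\<forall>x\<in>set p. b powi (q0 - 1) < x"
  shows "scaling_cost_from b p (q0 - int m) + (real (length p))\<^sup>2 * (b powi (q0 - int m) / (b - 1)) =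
         scaling_cost_from b p q0 + (real (length p))\<^sup>2 * (b powi q0 / (b - 1))"
proof (induction m)
  case 0
  then show ?case by simp
next
  case (Suc m)
  let ?q = "q0 - int (Suc m)"
  have q: "?q + 1 = q0 - int m" by simp
  have "b powi ?q \<le> b powi (q0 - 1)"
    using assms(1) by (intro power_int_increasing) auto
  then have s: "\<forall>x\<in>set p. b powi ?q < x"
    using small by fastforce
  have "b powi (q0 - int m) = b powi ?q * b"
    unfolding q[symmetric] using assms(1) by (subst power_int_add) auto
  then have "b powi ?q + b powi ?q / (b - 1) = b powi (q0 - int m) / (b - 1)"
    using assms(1) by (simp add: field_simps)
  then have "(real (length p))\<^sup>2 * b powi ?q + (real (length p))\<^sup>2 * (b powi ?q / (b - 1)) =
      (real (length p))\<^sup>2 * (b powi (q0 - int m) / (b - 1))"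
    by (metis distrib_left)
  with Suc scaling_cost_from_step[OF assms(1) s, unfolded q] show ?case
    by linarith
qed

lemma powi_at_bot:
  assumes "b > (1::real)"
  shows "((\<lambda>q::int. b powi q) \<longlongrightarrow> 0) at_bot"
proof (rule order_tendstoI)
  fix a :: real assume "a < 0"
  moreover have "b powi q > 0" for q using assms by simp
  ultimately show "\<forall>\<^sub>F q in at_bot. a < b powi q"
    by (intro always_eventually allI) (meson less_trans)
next
  fix a :: real assume a: "0 < a"
  obtain k where "inverse a < b ^ k"
    using real_arch_pow[OF assms] by blast
  then have k: "b powi (- int k) < a"
    using a assms by (simp add: power_int_minus field_simps)
  have "b powi q < a" if "q \<le> - int k" for q
  proof -
    have "b powi q \<le> b powi (- int k)"
      using assms that by (intro power_int_increasing) auto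
    with k show ?thesis by simp
  qed
  then show "\<forall>\<^sub>F q in at_bot. b powi q < a"
    by (auto simp: eventually_at_bot_linorder)
qed

lemma scaling_cost_from_tendsto_aux:
  assumes "b > 1" and small: "\<forall>x\<in>set p. b powi (q0 - 1) < x"
  shows "(scaling_cost_from b p \<longlongrightarrow>
           scaling_cost_from b p q0 + (real (length p))\<^sup>2 * (b powi q0 / (b - 1))) at_bot"
    (is "(_ \<longlongrightarrow> ?c) _")
proof -
  let ?f = "\<lambda>q. ?c - (real (length p))\<^sup>2 * (b powi q / (b - 1))"
  have "(?f \<longlongrightarrow> ?c - (real (length p))\<^sup>2 * (0 / (b - 1))) at_bot"
    using assms(1) by (intro tendsto_intros powi_at_bot) auto
  then have lim: "(?f \<longlongrightarrow> ?c) at_bot" by simp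
  have "?f q = scaling_cost_from b p q" if "q \<le> q0" for q
    using scaling_cost_from_start[OF assms, of "nat (q0 - q)"] that by simp
  then have "\<forall>\<^sub>F q in at_bot. ?f q = scaling_cost_from b p q"
    by (auto simp: eventually_at_bot_linorder)
  with lim show ?thesis by (rule Lim_transform_eventually)
qed

lemma scaling_cost_eq:
  assumes "b > 1" and "\<forall>x\<in>set p. b powi (q0 - 1) < x"
  shows "scaling_cost b p =
           scaling_cost_from b p q0 + (real (length p))\<^sup>2 * (b powi q0 / (b - 1))"
  unfolding scaling_cost_def
  by (rule tendsto_Lim[OF _ scaling_cost_from_tendsto_aux[OF assms]]) simp

lemma scaling_cost_from_tendsto:
  assumes "b > 1" and "is_instance p"
  shows "(scaling_cost_from b p \<longlongrightarrow> scaling_cost b p) at_bot"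
proof -
  have "\<forall>\<^sub>F q in at_bot. \<forall>x\<in>set p. b powi q < x"
    using assms order_tendstoD(2)[OF powi_at_bot[OF assms(1)]]
    by (intro eventually_ball_finite) (auto simp: is_instance_def)
  then obtain q where "\<forall>x\<in>set p. b powi q < x"
    by (auto simp: eventually_at_bot_linorder)
  then have small: "\<forall>x\<in>set p. b powi ((q + 1) - 1) < x" by simp
  show ?thesis
    using scaling_cost_from_tendsto_aux[OF assms(1) small] scaling_cost_eq[OF assms(1) small]
    by simp
qed

end

theory Submission imports Defs begin

text \<open>
  Take jobs of sizes \<open>b ^ k * (1 + e)\<close>, \<open>k \<le> L\<close>, each just too long for the round of length
  \<open>b ^ k\<close>, indexed by decreasing size, so that every round wastes its full length on each longer
  job before it completes the jobs it can. If \<open>N k\<close> jobs have level at least \<open>k\<close>, summation by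
  parts gives \<open>D\<^sub>b - OPT = (N 0)\<^sup>2 * b / (b - 1) + (\<Sum>k. N k * N (k + 1) * b ^ (k + 1))\<close>.
  For \<open>N k \<approx> M * b powr (- k / 2)\<close> every level contributes equally to this sum and to \<open>OPT\<close>, hence
  after \<open>M \<rightarrow> \<infinity>\<close> and \<open>e \<rightarrow> 0\<close> the boundary terms are negligible as \<open>L \<rightarrow> \<infinity>\<close>.
\<close>

section \<open>Runs of the scaling strategy\<close>

lemma fold_probe_Some: "snd s j = Some c \<Longrightarrow> snd (fold (probe p \<tau>) js s) j = Some c"
proof (induction js arbitrary: s)
  case (Cons i js)
  have "snd (probe p \<tau> i s) j = Some c"
    using Cons.prems by (cases s) auto
  then show ?case using Cons.IH by simp
qed simp

lemma scaling_run_Some: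
  assumes "k \<le> m" and "snd (scaling_run b p q0 k) j = Some c"
  shows "snd (scaling_run b p q0 m) j = Some c"
  using assms
  by (induction rule: dec_induct) (auto simp: probe_round_def intro: fold_probe_Some)

text \<open>Completion times never change once set, so any round by which all jobs are done can
  replace the \<open>LEAST\<close> one. For a staircase with levels below \<open>K\<close> this will
  be round count \<open>K\<close>.\<close>

lemma scaling_cost_from_all_done:
  assumes "all_done p (scaling_run b p q0 m)"
  shows "scaling_cost_from b p q0 = (\<Sum>j<length p. the (snd (scaling_run b p q0 m) j))"
proof -
  define l where "l = (LEAST k. all_done p (scaling_run b p q0 k))"
  have l: "all_done p (scaling_run b p q0 l)" and "l \<le> m"
    unfolding l_def using assms by (auto intro: LeastI Least_le)
  have "snd (scaling_run b p q0 l) j = snd (scaling_run b p q0 m) j" if "j < length p" for j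
    using l that scaling_run_Some[OF \<open>l \<le> m\<close>, of b p q0 j] by (auto simp: all_done_def)
  then show ?thesis
    unfolding scaling_cost_from_def l_def[symmetric] by (intro sum.cong) auto
qed

text \<open>On a staircase a round meets three consecutive index ranges: jobs still too long, jobs
  that fit, jobs already done. This lemma and the next two treat one range each.\<close>

lemma fold_probe_abort:
  assumes "\<And>j. j \<in> set js \<Longrightarrow> C j = None \<and> \<tau> < p ! j"
  shows "fold (probe p \<tau>) js (t, C) = (t + real (length js) * \<tau>, C)"
  using assms
proof (induction js arbitrary: t)
  case (Cons j js)
  have "probe p \<tau> j (t, C) = (t + \<tau>, C)"
    using Cons.prems[of j] by simp
  then show ?case
    using Cons by (simp add: algebra_simps)
qed simp

lemma fold_probe_complete:
  assumes "\<And>j. a \<le> j \<Longrightarrow> j < a + n \<Longrightarrow> C j = None \<and> p ! j = x" and "x \<le> \<tau>"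
  shows "fold (probe p \<tau>) [a..<a + n] (t, C) =
    (t + real n * x, \<lambda>j. if a \<le> j \<and> j < a + n then Some (t + (real (j + 1) - real a) * x) else C j)"
  using assms
proof (induction n)
  case (Suc n)
  then show ?case
    by (auto simp: fun_eq_iff algebra_simps)
qed (auto simp: fun_eq_iff)

lemma fold_probe_skip:
  assumes "\<And>j. j \<in> set js \<Longrightarrow> C j \<noteq> None"
  shows "fold (probe p \<tau>) js (t, C) = (t, C)"
  using assms by (induction js) auto


section \<open>Summation over blocks\<close>

text \<open>The remainder up to \<open>N K\<close> carries the induction; it vanishes in the
  applications, where \<open>N K = 0\<close>.\<close>

lemma sum_blocks:
  fixes N :: "nat \<Rightarrow> nat" and g :: "nat \<Rightarrow> real"
  assumes "antimono N"
  shows "(\<Sum>j<N 0. g j) = (\<Sum>k<K. \<Sum>j=N (Suc k)..<N k. g j) + (\<Sum>j<N K. g j)"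
proof (induction K)
  case (Suc K)
  have "{..<N K} = {..<N (Suc K)} \<union> {N (Suc K)..<N K}"
    using antimonoD[OF assms, of K "Suc K"] by auto
  then have "(\<Sum>j<N K. g j) = (\<Sum>j<N (Suc K). g j) + (\<Sum>j=N (Suc K)..<N K. g j)"
    by (simp add: sum.union_disjoint ivl_disj_int)
  with Suc show ?case by simp
qed simp

lemma sum_Suc_ivl:
  assumes "a \<le> c"
  shows "(\<Sum>j=a..<c. real (j + 1)) = (real c * (real c + 1) - real a * (real a + 1)) / 2"
  using assms by (induction rule: dec_induct) (auto simp: field_simps)

text \<open>Turns waiting times counted per job into round lengths weighted by the number of jobs
  that outlast the round.\<close>

lemma sum_by_parts:
  fixes N a :: "nat \<Rightarrow> real"
  shows "(\<Sum>k<K. (N k - N (Suc k)) * (\<Sum>m<k. a m)) =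
    (\<Sum>k<K. N (Suc k) * a k) - N K * (\<Sum>m<K. a m)"
  by (induction K) (auto simp: algebra_simps)

text \<open>In the reversed order exactly the entries with index below \<open>j\<close> come after
  entry \<open>j\<close>, so it enters \<open>j + 1\<close> completion times.\<close>

lemma seq_cost_rev: "seq_cost (rev xs) = (\<Sum>j<length xs. real (j + 1) * xs ! j)"
proof (induction xs rule: rev_induct)
  case Nil
  then show ?case by (simp add: seq_cost_def)
next
  case (snoc x xs)
  have "(\<Sum>j<length xs. real (j + 1) * (xs @ [x]) ! j) = (\<Sum>j<length xs. real (j + 1) * xs ! j)"
    by (intro sum.cong) (auto simp: nth_append)
  with snoc show ?case by (simp add: seq_cost_Cons)
qed


section \<open>Staircase instances\<close>

text \<open>The index block from \<open>N (Suc k)\<close> to \<open>N k\<close> holds level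
  \<open>k\<close>, so larger jobs come first. The bound \<open>1 + e \<le> b\<close> lets level
  \<open>k\<close> complete in the round of length \<open>b ^ Suc k\<close>, and
  \<open>0 < e\<close> prevents it one round earlier.\<close>

locale staircase =
  fixes b e :: real and N :: "nat \<Rightarrow> nat" and K :: nat and p :: "real list"
  assumes b: "1 < b" and e: "0 < e" "1 + e \<le> b"
    and anti: "antimono N" and NK: "N K = 0" and len: "length p = N 0"
    and nth: "\<And>k j. N (Suc k) \<le> j \<Longrightarrow> j < N k \<Longrightarrow> p ! j = b ^ k * (1 + e)"
begin

text \<open>Blocks may be empty, so the level is found at the first place where \<open>N\<close>
  drops to \<open>j\<close> or below; \<open>N K = 0\<close> guarantees one.\<close>

lemma level_exists:
  assumes "j < N k"
  obtains m where "k \<le> m" "N (Suc m) \<le> j" "j < N m"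
proof -
  define l where "l = (LEAST m. N m \<le> j)"
  have l: "N l \<le> j"
    unfolding l_def by (rule LeastI[of _ K]) (simp add: NK)
  have "k < l"
    using l assms antimonoD[OF anti, of l k] by (meson leD le_less_trans not_le)
  then obtain m where m: "l = Suc m" "k \<le> m"
    by (cases l) auto
  have "j < N m"
    using not_less_Least[of m "\<lambda>m. N m \<le> j"] m by (simp add: l_def[symmetric])
  with l m that show thesis by blast
qed

text \<open>This is why a round of length \<open>b ^ k\<close> aborts every job of level at least
  \<open>k\<close>. For \<open>k = 0\<close> it shows that no job fits into length 1.\<close>

lemma nth_greater:
  assumes "j < N k"
  shows "b ^ k < p ! j"
proof -
  obtain m where m: "k \<le> m" "N (Suc m) \<le> j" "j < N m"
    using level_exists[OF assms] .
  have "b ^ k \<le> b ^ m"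
    using b m by (intro power_increasing) auto
  also have "\<dots> < b ^ m * (1 + e)"
    using b e by simp
  finally show ?thesis using nth m by simp
qed

lemma sorted_rev: "sorted (rev p)"
  unfolding sorted_rev_iff_nth_mono
proof (intro allI impI)
  fix i j assume ij: "i \<le> j" "j < length p"
  obtain m where m: "N (Suc m) \<le> j" "j < N m"
    using level_exists[of j 0] ij len by auto
  have "i < N m"
    using ij m by simp
  then obtain m' where m': "m \<le> m'" "N (Suc m') \<le> i" "i < N m'"
    by (rule level_exists)
  show "p ! j \<le> p ! i"
    using nth[OF m] nth[OF m'(2,3)] m'(1) b e by (simp add: power_increasing)
qed

section \<open>Optimal cost of a staircase\<close>

lemma OPT_eq_sum: "OPT p = (\<Sum>k<K. b ^ k * (1 + e) * (\<Sum>j=N (Suc k)..<N k. real (j + 1)))"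
proof -
  have "sort p = rev p"
    using sorted_rev by (intro properties_for_sort) auto
  then have "OPT p = (\<Sum>j<N 0. real (j + 1) * p ! j)"
    by (simp add: OPT_eq_sort seq_cost_rev len)
  also have "\<dots> = (\<Sum>k<K. \<Sum>j=N (Suc k)..<N k. real (j + 1) * p ! j)"
    using sum_blocks[OF anti, of _ K] by (simp add: NK)
  also have "\<dots> = (\<Sum>k<K. \<Sum>j=N (Suc k)..<N k. b ^ k * (1 + e) * real (j + 1))"
    by (intro sum.cong refl) (simp add: nth)
  finally show ?thesis by (simp only: sum_distrib_left)
qed

lemma OPT_eq:
  "OPT p = (1 + e) * (\<Sum>k<K. b ^ k *
    ((real (N k) * (real (N k) + 1) - real (N (Suc k)) * (real (N (Suc k)) + 1)) / 2))"
proof -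
  have "N (Suc k) \<le> N k" for k
    using anti by (simp add: antimonoD)
  then show ?thesis
    unfolding OPT_eq_sum sum_distrib_left[of "1 + e"]
    by (intro sum.cong refl) (simp only: sum_Suc_ivl mult_ac)
qed

section \<open>Schedule and cost of the scaling strategy on a staircase\<close>

definition round_length :: "nat \<Rightarrow> real" where
  "round_length k =
    real (N (Suc k)) * b ^ Suc k + (real (N k) - real (N (Suc k))) * (b ^ k * (1 + e))"

text \<open>Larger jobs have smaller indices, so the \<open>N (Suc k)\<close> aborted probes precede
  every completion of the round. The last summand covers the jobs of level \<open>k\<close> up to
  and including \<open>j\<close>.\<close>

definition completion :: "nat \<Rightarrow> nat \<Rightarrow> real" where
  "completion k j = (\<Sum>m<k. round_length m) + real (N (Suc k)) * b ^ Suc k +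
    (real (j + 1) - real (N (Suc k))) * (b ^ k * (1 + e))"

text \<open>The run starts with round 1, so its step \<open>k\<close>, counted from 0, probes for
  \<open>b ^ Suc k\<close> and completes exactly level \<open>k\<close>.\<close>

lemma run:
  "fst (scaling_run b p 1 k) = (\<Sum>m<k. round_length m) \<and>
   (\<forall>j<N k. snd (scaling_run b p 1 k) j = None) \<and>
   (\<forall>m<k. \<forall>j\<in>{N (Suc m)..<N m}. snd (scaling_run b p 1 k) j = Some (completion m j))"
proof (induction k)
  case (Suc k)
  let ?T = "\<Sum>m<k. round_length m" and ?\<tau> = "b ^ Suc k" and ?x = "b ^ k * (1 + e)"
  obtain C where C: "scaling_run b p 1 k = (?T, C)"
    using Suc by (metis prod.collapse)
  have none: "C j = None" if "j < N k" for j
    using Suc C that by auto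
  have some: "C j = Some (completion m j)" if "m < k" "N (Suc m) \<le> j" "j < N m" for m j
    using Suc C that by auto
  have le: "N (Suc k) \<le> N k" "N k \<le> N 0"
    using anti by (auto simp: antimonoD)
  define n where "n = N k - N (Suc k)"
  have n: "N (Suc k) + n = N k" "real n = real (N k) - real (N (Suc k))"
    using le by (auto simp: n_def of_nat_diff)
  define C' where "C' = (\<lambda>j. if N (Suc k) \<le> j \<and> j < N k then Some (completion k j) else C j)"
  have "[0..<length p] = [0..<N (Suc k)] @ [N (Suc k)..<N k] @ [N k..<N 0]"
    using le len by (metis append_assoc le0 le_trans upt_add_eq_append le_add_diff_inverse)
  then have "scaling_run b p 1 (Suc k) = fold (probe p ?\<tau>) [N k..<N 0]
      (fold (probe p ?\<tau>) [N (Suc k)..<N k] (fold (probe p ?\<tau>) [0..<N (Suc k)] (?T, C)))"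
    using b by (simp add: C probe_round_def power_int_add)
  also have "fold (probe p ?\<tau>) [0..<N (Suc k)] (?T, C) = (?T + real (N (Suc k)) * ?\<tau>, C)"
    using none nth_greater[of _ "Suc k"] le by (subst fold_probe_abort) auto
  also have "fold (probe p ?\<tau>) [N (Suc k)..<N k] \<dots> = (?T + round_length k, C')"
  proof -
    have "?x \<le> ?\<tau>" using b e by (simp add: mult_left_mono mult.commute)
    then have "fold (probe p ?\<tau>) [N (Suc k)..<N (Suc k) + n] (?T + real (N (Suc k)) * ?\<tau>, C) =
        (?T + real (N (Suc k)) * ?\<tau> + real n * ?x,
         \<lambda>j. if N (Suc k) \<le> j \<and> j < N (Suc k) + n
           then Some (?T + real (N (Suc k)) * ?\<tau> + (real (j + 1) - real (N (Suc k))) * ?x) else C j)"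
      using none nth n(1) by (intro fold_probe_complete) auto
    moreover have "?T + real (N (Suc k)) * ?\<tau> + real n * ?x = ?T + round_length k"
      by (simp only: n(2) round_length_def add.assoc)
    ultimately show ?thesis
      by (simp only: n(1) C'_def completion_def)
  qed
  also have "fold (probe p ?\<tau>) [N k..<N 0] \<dots> = (?T + round_length k, C')"
  proof (rule fold_probe_skip)
    fix j assume j: "j \<in> set [N k..<N 0]"
    then obtain m where m: "N (Suc m) \<le> j" "j < N m"
      using level_exists[of j 0] by auto
    have "m < k"
      using m j antimonoD[OF anti, of k m] by (metis atLeastLessThan_iff leD le_trans not_le set_upt)
    then show "C' j \<noteq> None" using some m by (auto simp: C'_def)
  qed
  finally have run: "scaling_run b p 1 (Suc k) = (?T + round_length k, C')" .
  have "C' j = Some (completion m j)" if "m < Suc k" "N (Suc m) \<le> j" "j < N m" for m j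
  proof (cases "m = k")
    case False
    then have "m < k" using that by simp
    \<comment> \<open>Earlier levels lie at indices from \<open>N k\<close> on, outside the block
      that \<open>C'\<close> overwrites.\<close>
    then have "N k \<le> N (Suc m)" using anti by (simp add: antimonoD)
    then show ?thesis using some[OF \<open>m < k\<close>] that by (simp add: C'_def)
  qed (use that in \<open>simp add: C'_def\<close>)
  then show ?case
    unfolding run using none le by (auto simp: C'_def)
qed auto

lemma scaling_cost_from_eq:
  "scaling_cost_from b p 1 = OPT p + b * (\<Sum>k<K. b ^ k * (real (N k) * real (N (Suc k))))"
proof -
  let ?N = "\<lambda>k. real (N k)" and ?T = "\<lambda>k. \<Sum>m<k. round_length m"
  have le: "N (Suc k) \<le> N k" for k
    using anti by (simp add: antimonoD)
  have "snd (scaling_run b p 1 K) j \<noteq> None" if j: "j < N 0" for j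
  proof -
    obtain m where m: "N (Suc m) \<le> j" "j < N m"
      using level_exists[OF j] by blast
    moreover have "m < K"
      using m(2) NK antimonoD[OF anti, of K m] by (metis le_zero_eq not_le not_less0)
    ultimately show ?thesis using run[of K] by auto
  qed
  then have "all_done p (scaling_run b p 1 K)"
    by (simp add: all_done_def len)
  then have "scaling_cost_from b p 1 = (\<Sum>j<N 0. the (snd (scaling_run b p 1 K) j))"
    by (simp add: scaling_cost_from_all_done len)
  also have "\<dots> = (\<Sum>k<K. \<Sum>j=N (Suc k)..<N k. the (snd (scaling_run b p 1 K) j))"
    using sum_blocks[OF anti, of _ K] by (simp add: NK)
  also have "\<dots> = (\<Sum>k<K. \<Sum>j=N (Suc k)..<N k. completion k j)"
    using run[of K] by (intro sum.cong refl) auto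
  \<comment> \<open>Within a block, \<open>completion k j\<close> is the contribution of
    \<open>j\<close> to the optimum plus a delay that does not depend on \<open>j\<close>.\<close>
  also have "\<dots> = (\<Sum>k<K. b ^ k * (1 + e) * (\<Sum>j=N (Suc k)..<N k. real (j + 1)) +
      (?N k - ?N (Suc k)) * (?T k + ?N (Suc k) * b ^ Suc k - ?N (Suc k) * (b ^ k * (1 + e))))"
  proof (intro sum.cong refl)
    fix k
    let ?c = "?T k + ?N (Suc k) * b ^ Suc k - ?N (Suc k) * (b ^ k * (1 + e))"
    have "(\<Sum>j=N (Suc k)..<N k. completion k j) =
        (\<Sum>j=N (Suc k)..<N k. b ^ k * (1 + e) * real (j + 1) + ?c)"
      by (intro sum.cong refl) (simp add: completion_def algebra_simps)
    then show "(\<Sum>j=N (Suc k)..<N k. completion k j) =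
        b ^ k * (1 + e) * (\<Sum>j=N (Suc k)..<N k. real (j + 1)) + (?N k - ?N (Suc k)) * ?c"
      using le[of k] by (simp only: sum.distrib sum_distrib_left sum_constant card_atLeastLessThan of_nat_diff)
  qed
  also have "\<dots> = OPT p + ((\<Sum>k<K. (?N k - ?N (Suc k)) * ?T k) +
      (\<Sum>k<K. (?N k - ?N (Suc k)) * (?N (Suc k) * b ^ Suc k - ?N (Suc k) * (b ^ k * (1 + e)))))"
    unfolding OPT_eq_sum sum.distrib[symmetric] by (intro sum.cong refl) algebra
  \<comment> \<open>Round \<open>k\<close> delays the \<open>N (Suc k)\<close> jobs that remain
    after it; the boundary term is zero by \<open>N K = 0\<close>.\<close>
  also have "(\<Sum>k<K. (?N k - ?N (Suc k)) * ?T k) = (\<Sum>k<K. ?N (Suc k) * round_length k)"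
    using sum_by_parts[of ?N round_length K] NK by simp
  \<comment> \<open>All terms with \<open>1 + e\<close> cancel: what delays the remaining jobs in
    \<open>round_length k\<close> is offset by the correction inside block \<open>k\<close>.\<close>
  also have "\<dots> + (\<Sum>k<K. (?N k - ?N (Suc k)) * (?N (Suc k) * b ^ Suc k - ?N (Suc k) * (b ^ k * (1 + e)))) =
      b * (\<Sum>k<K. b ^ k * (?N k * ?N (Suc k)))"
    unfolding sum_distrib_left sum.distrib[symmetric]
    by (intro sum.cong refl) (simp add: round_length_def algebra_simps)
  finally show ?thesis .
qed

text \<open>All jobs exceed \<open>1 = b ^ 0\<close>, so the rounds up to 0 complete nothing. Their
  lengths sum to \<open>b / (b - 1)\<close> for each job, and this total over all jobs delays every
  completion.\<close>

lemma scaling_cost_staircase: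
  "scaling_cost b p = OPT p + ((real (N 0))\<^sup>2 * (b / (b - 1)) +
    b * (\<Sum>k<K. b ^ k * (real (N k) * real (N (Suc k)))))"
proof -
  have "\<forall>x\<in>set p. b powi (1 - 1) < x"
    using nth_greater[of _ 0] by (auto simp: in_set_conv_nth len)
  from scaling_cost_eq[OF b this] show ?thesis
    by (simp add: scaling_cost_from_eq len)
qed

lemma is_instance_staircase:
  assumes "0 < N 0"
  shows "is_instance p"
proof -
  have "0 < p ! j" if "j < N 0" for j
    using nth_greater[OF that] by simp
  then show ?thesis
    using assms len by (auto simp: is_instance_def in_set_conv_nth)
qed

end

text \<open>The level of an index is recovered as the least \<open>k\<close> with
  \<open>N (Suc k) \<le> j\<close>, which also works across empty blocks.\<close>

lemma staircase_exists:
  assumes "1 < b" "0 < e" "1 + e \<le> b" "antimono N" "N K = 0"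
  shows "\<exists>p. staircase b e N K p"
proof
  let ?p = "map (\<lambda>j. b ^ (LEAST k. N (Suc k) \<le> j) * (1 + e)) [0..<N 0]"
  have "(LEAST k. N (Suc k) \<le> j) = k" if "N (Suc k) \<le> j" "j < N k" for j k
  proof (rule Least_equality)
    fix m assume "N (Suc m) \<le> j"
    with that(2) have "N (Suc m) < N k" by simp
    then show "k \<le> m"
      using antimonoD[OF assms(4), of "Suc m" k] by (meson leD not_less_eq_eq)
  qed fact
  moreover have "j < N 0" if "j < N k" for j k
    using that antimonoD[OF assms(4), of 0 k] by simp
  ultimately show "staircase b e N K ?p"
    using assms by unfold_locales auto
qed


section \<open>The limit\<close>

lemma nat_floor_over_tendsto:
  assumes "0 \<le> (c::real)"
  shows "(\<lambda>M. real (nat \<lfloor>real (Suc M) * c\<rfloor>) / real (Suc M)) \<longlonglongrightarrow> c"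
proof (rule tendsto_sandwich)
  show "\<forall>\<^sub>F M in sequentially. c - 1 / real (Suc M) \<le> real (nat \<lfloor>real (Suc M) * c\<rfloor>) / real (Suc M)"
  proof (intro always_eventually allI)
    fix M
    have "real (Suc M) * c - 1 \<le> real (nat \<lfloor>real (Suc M) * c\<rfloor>)"
      using assms by linarith
    then have "(real (Suc M) * c - 1) / real (Suc M) \<le> real (nat \<lfloor>real (Suc M) * c\<rfloor>) / real (Suc M)"
      by (intro divide_right_mono) auto
    then show "c - 1 / real (Suc M) \<le> real (nat \<lfloor>real (Suc M) * c\<rfloor>) / real (Suc M)"
      by (simp add: diff_divide_distrib del: of_nat_Suc)
  qed
  show "\<forall>\<^sub>F M in sequentially. real (nat \<lfloor>real (Suc M) * c\<rfloor>) / real (Suc M) \<le> c"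
  proof (intro always_eventually allI)
    fix M
    have "0 \<le> real (Suc M) * c" using assms by simp
    then have "real (nat \<lfloor>real (Suc M) * c\<rfloor>) \<le> real (Suc M) * c"
      by linarith
    then show "real (nat \<lfloor>real (Suc M) * c\<rfloor>) / real (Suc M) \<le> c"
      by (simp add: field_simps del: of_nat_Suc)
  qed
  show "(\<lambda>M. c - 1 / real (Suc M)) \<longlonglongrightarrow> c"
    using tendsto_diff[OF tendsto_const LIMSEQ_inverse_real_of_nat, of c] by (simp add: inverse_eq_divide)
qed simp

text \<open>For fixed \<open>L\<close>, both the excess over the optimum and the optimum grow like
  the square of \<open>Suc M\<close>. After division by that square the rounding of job counts and
  the slack \<open>e\<close> disappear in the limit.\<close>

lemma staircase_ratio:
  fixes b s :: real
  assumes b: "1 < b" and s: "0 < s" "s < 1" "b * s\<^sup>2 = 1"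
  shows "\<exists>p. (\<forall>M. is_instance (p M)) \<and>
    (\<lambda>M::nat. scaling_cost b (p M) / OPT (p M)) \<longlonglongrightarrow>
      1 + (b / (b - 1) + b * (real L * s)) / ((real L * (1 - s\<^sup>2) + 1) / 2)"
proof -
  \<comment> \<open>The limiting fraction of jobs of level at least \<open>k\<close>; the cutoff
    after \<open>L\<close> yields \<open>N M K = 0\<close> for \<open>K = Suc L\<close>.\<close>
  define z where "z k = (if k \<le> L then s ^ k else 0)" for k
  define N where "N M k = nat \<lfloor>real (Suc M) * z k\<rfloor>" for M k
  \<comment> \<open>This choice tends to 0 and satisfies \<open>1 + e M \<le> b\<close> already for
    \<open>M = 0\<close>.\<close>
  define e where "e M = (b - 1) / real (Suc M)" for M
  define K where "K = Suc L"
  have z_nonneg: "0 \<le> z k" for k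
    using s by (simp add: z_def)
  have z_anti: "antimono z"
    unfolding antimono_def using s by (auto simp: z_def intro: power_decreasing)
  have "\<exists>p. staircase b (e M) (N M) K p" for M
  proof (rule staircase_exists)
    show "antimono (N M)"
      unfolding antimono_def N_def using antimonoD[OF z_anti]
      by (intro allI impI nat_mono floor_mono mult_left_mono) auto
    have "(b - 1) * 1 \<le> (b - 1) * real (Suc M)"
      using b by (intro mult_left_mono) auto
    then show "1 + e M \<le> b"
      using b by (simp add: e_def field_simps)
  qed (use b in \<open>auto simp: e_def N_def K_def z_def\<close>)
  then obtain p where p: "staircase b (e M) (N M) K (p M)" for M
    by metis
  have inst: "is_instance (p M)" for M
    by (rule staircase.is_instance_staircase[OF p]) (simp add: N_def z_def)
  define y where "y M k = real (N M k) / real (Suc M)" for M k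
  have y: "real (N M k) = real (Suc M) * y M k" for M k
    by (simp add: y_def)
  \<comment> \<open>\<open>A\<close> is the normalized excess over the optimum and \<open>B\<close>
    the normalized optimum; \<open>1 / real (Suc M)\<close> in \<open>B\<close> stems from the
    lower-order terms of the triangular numbers.\<close>
  define A where "A M = (y M 0)\<^sup>2 * (b / (b - 1)) + b * (\<Sum>k<K. b ^ k * (y M k * y M (Suc k)))" for M
  define B where "B M = (1 + e M) * (\<Sum>k<K. b ^ k * ((y M k * (y M k + 1 / real (Suc M)) -
      y M (Suc k) * (y M (Suc k) + 1 / real (Suc M))) / 2))" for M
  have num: "scaling_cost b (p M) = OPT (p M) + (real (Suc M))\<^sup>2 * A M" for M
    unfolding staircase.scaling_cost_staircase[OF p] y A_def
    by (simp add: power_mult_distrib distrib_left sum_distrib_left power2_eq_square mult_ac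
        del: of_nat_Suc)
  have den: "OPT (p M) = (real (Suc M))\<^sup>2 * B M" for M
  proof -
    have sq: "c * u * (c * u + 1) = c\<^sup>2 * (u * (u + 1 / c))" if "c > 0" for c u :: real
    proof -
      have "c * u + 1 = c * (u + 1 / c)"
        using that by (simp add: distrib_left)
      then show ?thesis by (simp add: power2_eq_square mult_ac)
    qed
    have factor: "(\<Sum>k<K. b ^ k * ((c * g k - c * h k) / 2)) = c * (\<Sum>k<K. b ^ k * ((g k - h k) / 2))"
      for c and g h :: "nat \<Rightarrow> real"
      unfolding sum_distrib_left by (intro sum.cong refl) (simp add: right_diff_distrib[symmetric])
    show ?thesis
      unfolding staircase.OPT_eq[OF p] y B_def sq[OF of_nat_0_less_iff[THEN iffD2, OF zero_less_Suc]] factor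
      by (rule mult.left_commute)
  qed
  have y_lim: "(\<lambda>M. y M k) \<longlonglongrightarrow> z k" for k
    unfolding y_def N_def by (rule nat_floor_over_tendsto) (rule z_nonneg)
  have inv_lim: "(\<lambda>M. 1 / real (Suc M)) \<longlonglongrightarrow> 0"
    using LIMSEQ_inverse_real_of_nat by (simp add: inverse_eq_divide)
  have e_lim: "e \<longlonglongrightarrow> 0"
    using tendsto_mult[OF tendsto_const inv_lim, of "b - 1"] by (simp add: e_def[abs_def])
  \<comment> \<open>The geometric rate is chosen for this: growth of the sizes balances the decay of
    the squared job counts, so all levels weigh the same.\<close>
  have level: "b ^ k * s ^ k * s ^ k = 1" for k
    using s(3) by (simp add: power_mult_distrib[symmetric] power2_eq_square mult_ac)
  have "A \<longlonglongrightarrow> (z 0)\<^sup>2 * (b / (b - 1)) + b * (\<Sum>k<K. b ^ k * (z k * z (Suc k)))"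
    unfolding A_def by (intro tendsto_intros y_lim)
  \<comment> \<open>The summand at \<open>L\<close> vanishes because \<open>z (Suc L) = 0\<close>,
    which leaves \<open>L\<close> equal summands.\<close>
  moreover have "(\<Sum>k<K. b ^ k * (z k * z (Suc k))) = (\<Sum>k<L. b ^ k * s ^ k * s ^ k * s)"
    by (simp add: K_def z_def mult_ac)
  then have "(\<Sum>k<K. b ^ k * (z k * z (Suc k))) = real L * s"
    by (simp add: level)
  ultimately have A_lim: "A \<longlonglongrightarrow> b / (b - 1) + b * (real L * s)"
    by (simp add: z_def)
  have "B \<longlonglongrightarrow> (1 + 0) * (\<Sum>k<K. b ^ k * ((z k * (z k + 0) - z (Suc k) * (z (Suc k) + 0)) / 2))"
    unfolding B_def by (intro tendsto_intros y_lim inv_lim e_lim) auto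
  moreover have "(\<Sum>k<K. b ^ k * ((z k * (z k + 0) - z (Suc k) * (z (Suc k) + 0)) / 2)) =
      (\<Sum>k<L. b ^ k * s ^ k * s ^ k * ((1 - s\<^sup>2) / 2)) + b ^ L * s ^ L * s ^ L / 2"
  proof -
    have "(\<Sum>k<L. b ^ k * ((z k * (z k + 0) - z (Suc k) * (z (Suc k) + 0)) / 2)) =
        (\<Sum>k<L. b ^ k * s ^ k * s ^ k * ((1 - s\<^sup>2) / 2))"
      by (intro sum.cong refl) (simp add: z_def field_simps power2_eq_square)
    \<comment> \<open>No level lies above the top one, so its share is \<open>1 / 2\<close> instead
      of \<open>(1 - s\<^sup>2) / 2\<close>.\<close>
    moreover have "b ^ L * ((z L * (z L + 0) - z (Suc L) * (z (Suc L) + 0)) / 2) =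
        b ^ L * s ^ L * s ^ L / 2"
      by (simp add: z_def)
    ultimately show ?thesis
      by (simp only: K_def sum.lessThan_Suc)
  qed
  ultimately have B_lim: "B \<longlonglongrightarrow> (real L * (1 - s\<^sup>2) + 1) / 2"
    by (simp add: level add_divide_distrib)
  have "0 \<le> 1 - s\<^sup>2"
    using s by (simp add: power_le_one)
  then have pos: "0 < (real L * (1 - s\<^sup>2) + 1) / 2"
    by (simp add: add_nonneg_pos)
  have "\<forall>\<^sub>F M in sequentially. 0 < B M"
    using order_tendstoD(1)[OF B_lim pos] .
  then have "\<forall>\<^sub>F M in sequentially. 1 + A M / B M = scaling_cost b (p M) / OPT (p M)"
  proof eventually_elim
    case (elim M)
    then show ?case
      unfolding num den by (simp add: add_divide_distrib del: of_nat_Suc)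
  qed
  moreover have "(\<lambda>M. 1 + A M / B M) \<longlonglongrightarrow>
      1 + (b / (b - 1) + b * (real L * s)) / ((real L * (1 - s\<^sup>2) + 1) / 2)"
    using pos by (intro tendsto_intros A_lim B_lim) auto
  ultimately have "(\<lambda>M. scaling_cost b (p M) / OPT (p M)) \<longlonglongrightarrow>
      1 + (b / (b - 1) + b * (real L * s)) / ((real L * (1 - s\<^sup>2) + 1) / 2)"
    by (rule Lim_transform_eventually[rotated])
  with inst show ?thesis by blast
qed

section \<open>Number of levels tending to infinity\<close>

lemma linear_ratio_tendsto:
  fixes a c d g :: real
  assumes "d \<noteq> 0"
  shows "(\<lambda>n. (a + real n * c) / (g + real n * d)) \<longlonglongrightarrow> c / d"
proof -
  have inv: "(\<lambda>n. u * (1 / real n) + v) \<longlonglongrightarrow> u * 0 + v" for u v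
    by (intro tendsto_intros lim_1_over_n)
  have "(\<lambda>n. (a * (1 / real n) + c) / (g * (1 / real n) + d)) \<longlonglongrightarrow> (a * 0 + c) / (g * 0 + d)"
    using assms by (intro tendsto_divide inv) auto
  moreover have "\<forall>\<^sub>F n in sequentially. (a * (1 / real n) + c) / (g * (1 / real n) + d) =
      (a + real n * c) / (g + real n * d)"
    using eventually_gt_at_top[of 0]
  proof eventually_elim
    case (elim n)
    have "a + real n * c = real n * (a * (1 / real n) + c)"
      and "g + real n * d = real n * (g * (1 / real n) + d)"
      using elim by (auto simp: distrib_left)
    then show ?case using elim by simp
  qed
  ultimately show ?thesis
    by (auto dest: Lim_transform_eventually)
qed

theorem theorem1p3:
  fixes b :: real
  assumes "b > 1"
  shows "\<exists>p :: nat \<Rightarrow> real list.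
    (\<forall>L. is_instance (p L)) \<and>
    (\<lambda>L. scaling_cost b (p L) / OPT (p L)) \<longlonglongrightarrow> 1 + 2 * b powr (3/2) / (b - 1)"
proof -
  define s where "s = 1 / sqrt b"
  have s: "0 < s" "s < 1" "b * s\<^sup>2 = 1"
    using assms by (auto simp: s_def power_divide)
  define R where "R L = 1 + (b / (b - 1) + b * (real L * s)) / ((real L * (1 - s\<^sup>2) + 1) / 2)" for L
  \<comment> \<open>Diagonal choice: for each \<open>L\<close>, one instance with \<open>M\<close>
    so large that its ratio is within \<open>1 / real (Suc L)\<close> of the limit
    \<open>R L\<close>. The ratios then have the same limit as \<open>R\<close>.\<close>
  have "\<exists>p. is_instance p \<and> dist (scaling_cost b p / OPT p) (R L) < 1 / real (Suc L)" for L
  proof -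
    obtain p where p: "\<And>M. is_instance (p M)" "(\<lambda>M::nat. scaling_cost b (p M) / OPT (p M)) \<longlonglongrightarrow> R L"
      using staircase_ratio[OF assms s, of L] unfolding R_def by blast
    have "\<forall>\<^sub>F M in sequentially. dist (scaling_cost b (p M) / OPT (p M)) (R L) < 1 / real (Suc L)"
      by (rule tendstoD[OF p(2)]) simp
    then obtain M where "dist (scaling_cost b (p M) / OPT (p M)) (R L) < 1 / real (Suc L)"
      by (auto simp: eventually_sequentially)
    with p(1) show ?thesis by blast
  qed
  then obtain p where p: "\<And>L. is_instance (p L)"
      "\<And>L. dist (scaling_cost b (p L) / OPT (p L)) (R L) < 1 / real (Suc L)"
    by metis
  have "(\<lambda>L. 1 / real (Suc L)) \<longlonglongrightarrow> 0"
    using LIMSEQ_inverse_real_of_nat by (simp add: inverse_eq_divide)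
  then have diff: "(\<lambda>L. scaling_cost b (p L) / OPT (p L) - R L) \<longlonglongrightarrow> 0"
  proof (rule tendsto_0_le[where K = 1], intro always_eventually allI)
    fix L
    show "norm (scaling_cost b (p L) / OPT (p L) - R L) \<le> norm (1 / real (Suc L)) * 1"
      using p(2)[of L] by (simp add: dist_norm del: of_nat_Suc)
  qed
  have "s\<^sup>2 < 1"
    using s by (simp add: power_less_one_iff)
  then have "(\<lambda>L. 1 + (b / (b - 1) + real L * (b * s)) / (1 / 2 + real L * ((1 - s\<^sup>2) / 2)))
      \<longlonglongrightarrow> 1 + b * s / ((1 - s\<^sup>2) / 2)"
    by (intro tendsto_intros linear_ratio_tendsto) simp
  then have "R \<longlonglongrightarrow> 1 + b * s / ((1 - s\<^sup>2) / 2)"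
    by (simp add: R_def[abs_def] add_divide_distrib mult_ac add_ac)
  \<comment> \<open>Both sides agree since \<open>b * s\<^sup>2 = 1\<close> gives
    \<open>sqrt b = b * s\<close> and \<open>b - 1 = b * (1 - s\<^sup>2)\<close>.\<close>
  also have "b * s / ((1 - s\<^sup>2) / 2) = 2 * b powr (3/2) / (b - 1)"
  proof -
    have "b powr (3/2) = b powr (1 + 1/2)" by simp
    also have "\<dots> = b * sqrt b"
      using assms by (subst powr_add) (simp add: powr_half_sqrt)
    also have "sqrt b = b * s"
      using assms by (simp add: s_def real_div_sqrt)
    finally have powr: "b powr (3/2) = b * (b * s)" .
    have denom: "b - 1 = b * (1 - s\<^sup>2)"
      using s(3) by (simp add: right_diff_distrib)
    then have "b * s / ((1 - s\<^sup>2) / 2) = 2 * (b * (b * s)) / (b - 1)"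
      unfolding denom using assms by simp
    then show ?thesis by (simp only: powr)
  qed
  finally have "R \<longlonglongrightarrow> 1 + 2 * b powr (3/2) / (b - 1)" .
  from tendsto_add[OF diff this] p(1) show ?thesis
    by (intro exI[of _ p]) simp
qed

end
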